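(* For every point-tree hypergraph $H$, $\sigma(H) \le \nu(H)$.
   Context: A hypergraph $H$ is called a point-tree hypergraph if, for some set $X$ and a tree $T$ whose vertex set $V(T)$ is disjoint from $X$, each edge $e \in H$ is of the form $\{x\} \cup V(t)$, where $x = x(e) \in X$ and $t = t(e)$ is a subtree of $T$. For two hypergraphs $H$ and $F$ on the same vertex set, a subset $C \subseteq F$ is $H$-covering if every edge of $H$ meets some edge from $C$; the $F$-width $w(H,F)$ of $H$ is the minimal size of an $H$-covering set of edges from $F$. For a point-tree hypergraph $H$ (with a set $X$ and a tree $T$ whose vertex set $V(T)$ is disjoint from $X$, each edge $e \in H$ being of the form $e = \{x(e)\} \cup V(t(e))$, where $x(e) \in X$ and $t(e)$ is a subtree of $T$), let $F(H) = \{\{x(e)\} : e \in H\} \cup \{V(t(e)) : e \in H\}$, and define $\sigma(H) = w(H, F(H))$. The matching number $\nu(H)$ of a hypergraph $H$ is the maximal size of a matching in $H$, a matching being a set of pairwise disjoint edges. *)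

theory Defs
  imports "HOL-Library.Disjoint_Sets"
begin

text \<open>
  Graphs are undirected, simple and possibly infinite; edges are two-element vertex sets.
  The \<open>tree\<close> predicate of the AFP entry Graph\_Theory is not used: it only excludes directed
  cycles, so an acyclically oriented triangle satisfies it, while a symmetric digraph with an
  arc never does.
\<close>

record 'a ugraph =
  verts :: "'a set"
  edges :: "'a set set"

definition simple_graph :: "'a ugraph \<Rightarrow> bool" where
  "simple_graph G \<longleftrightarrow> (\<forall>e\<in>edges G. e \<subseteq> verts G \<and> card e = 2)"

definition walk :: "'a ugraph \<Rightarrow> 'a list \<Rightarrow> bool" where
  "walk G p \<longleftrightarrow> p \<noteq> [] \<and> set p \<subseteq> verts G \<and>
     (\<forall>i. Suc i < length p \<longrightarrow> {p ! i, p ! Suc i} \<in> edges G)"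

definition connected_graph :: "'a ugraph \<Rightarrow> bool" where
  "connected_graph G \<longleftrightarrow> verts G \<noteq> {} \<and>
     (\<forall>u\<in>verts G. \<forall>v\<in>verts G. \<exists>p. walk G p \<and> hd p = u \<and> last p = v)"

text \<open>A cycle is listed without repeating its first vertex at the end.\<close>

definition cycle :: "'a ugraph \<Rightarrow> 'a list \<Rightarrow> bool" where
  "cycle G p \<longleftrightarrow> walk G p \<and> distinct p \<and> 3 \<le> length p \<and> {last p, hd p} \<in> edges G"

definition tree :: "'a ugraph \<Rightarrow> bool" where
  "tree G \<longleftrightarrow> simple_graph G \<and> connected_graph G \<and> (\<nexists>p. cycle G p)"

definition subtree :: "'a ugraph \<Rightarrow> 'a ugraph \<Rightarrow> bool" where
  "subtree S T \<longleftrightarrow> tree S \<and> verts S \<subseteq> verts T \<and> edges S \<subseteq> edges T"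

text \<open>
  A hypergraph is given by its set of edges. The set \<open>X\<close> and the tree \<open>T\<close> are parameters
  because the decomposition of an edge into its point and its subtree, and with it \<open>F(H)\<close>,
  depends on them.
\<close>

definition point_tree_hypergraph :: "'a set \<Rightarrow> 'a ugraph \<Rightarrow> 'a set set \<Rightarrow> bool" where
  "point_tree_hypergraph X T H \<longleftrightarrow> tree T \<and> X \<inter> verts T = {} \<and>
     (\<forall>e\<in>H. \<exists>x\<in>X. \<exists>t. subtree t T \<and> e = {x} \<union> verts t)"

definition H_covering :: "'a set set \<Rightarrow> 'a set set \<Rightarrow> bool" where
  "H_covering H C \<longleftrightarrow> (\<forall>e\<in>H. \<exists>c\<in>C. e \<inter> c \<noteq> {})"

text \<open>Unspecified if \<open>H\<close> has no finite covering by edges of \<open>F\<close>.\<close>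

definition width :: "'a set set \<Rightarrow> 'a set set \<Rightarrow> nat" where
  "width H F = (LEAST n. \<exists>C\<subseteq>F. finite C \<and> H_covering H C \<and> card C = n)"

text \<open>
  Since \<open>X\<close> and the vertex set of \<open>T\<close> are disjoint, an edge of \<open>H\<close> has only one decomposition
  \<open>{x} \<union> verts t\<close> up to the choice of \<open>edges t\<close> (which does not affect \<open>verts t\<close>).
\<close>

definition point_tree_parts :: "'a set \<Rightarrow> 'a ugraph \<Rightarrow> 'a set set \<Rightarrow> 'a set set" where
  "point_tree_parts X T H =
     {{x} | x t. x \<in> X \<and> subtree t T \<and> {x} \<union> verts t \<in> H} \<union>
     {verts t | x t. x \<in> X \<and> subtree t T \<and> {x} \<union> verts t \<in> H}"

definition sigma :: "'a set \<Rightarrow> 'a ugraph \<Rightarrow> 'a set set \<Rightarrow> nat" where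
  "sigma X T H = width H (point_tree_parts X T H)"

definition matching :: "'a set set \<Rightarrow> 'a set set \<Rightarrow> bool" where
  "matching H M \<longleftrightarrow> M \<subseteq> H \<and> disjoint M"

text \<open>Intended for finite \<open>H\<close> only.\<close>

definition matching_number :: "'a set set \<Rightarrow> nat" where
  "matching_number H = Max {card M | M. matching H M}"

text \<open>For finite \<open>H\<close> the minimum defining \<open>sigma\<close> and the maximum defining
  \<open>matching_number\<close> are attained.\<close>

lemma finite_covering_exists:
  assumes "point_tree_hypergraph X T H" and "finite H"
  shows "\<exists>C\<subseteq>point_tree_parts X T H. finite C \<and> H_covering H C"
proof -
  have "\<exists>x. {x} \<in> point_tree_parts X T H \<and> x \<in> e" if "e \<in> H" for e
  proof -
    obtain x t where e: "x \<in> X" "subtree t T" "e = {x} \<union> verts t"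
      using assms(1) \<open>e \<in> H\<close> unfolding point_tree_hypergraph_def by meson
    then have "{x} \<in> point_tree_parts X T H"
      using \<open>e \<in> H\<close> unfolding point_tree_parts_def by (intro UnI1 CollectI exI) auto
    then show ?thesis
      using e(3) by (intro exI[of _ x]) simp
  qed
  then obtain x where x: "\<forall>e\<in>H. {x e} \<in> point_tree_parts X T H \<and> x e \<in> e"
    by (metis (no_types))
  have "H_covering H ((\<lambda>e. {x e}) ` H)"
    unfolding H_covering_def
  proof
    fix e
    assume "e \<in> H"
    then show "\<exists>c\<in>(\<lambda>e. {x e}) ` H. e \<inter> c \<noteq> {}"
      using x by (intro bexI[of _ "{x e}"]) auto
  qed
  moreover have "(\<lambda>e. {x e}) ` H \<subseteq> point_tree_parts X T H"
    using x by auto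
  ultimately show ?thesis
    using assms(2) finite_imageI by metis
qed

lemma matching_number_attained:
  assumes "finite H"
  shows "\<exists>M. matching H M \<and> card M = matching_number H"
proof -
  have "{card M | M. matching H M} = card ` {M. matching H M}"
    by blast
  moreover have "finite {M. matching H M}"
    by (rule finite_subset[of _ "Pow H"]) (use assms in \<open>auto simp: matching_def\<close>)
  moreover have "matching H {}"
    by (simp add: matching_def)
  ultimately have "matching_number H \<in> {card M | M. matching H M}"
    unfolding matching_number_def by (intro Max_in) auto
  then show ?thesis
    by auto
qed

end

theory Submission
  imports Defs "HOL-Library.Z2"
begin

text \<open>
  Call two edges of \<open>H\<close> adjacent if their subtrees meet, and colour an edge by its point. The graph
  is chordal, a matching of \<open>H\<close> is a rainbow independent set, and a covering amounts to a set \<open>S\<close> of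
  colours together with a set of edges dominating all edges coloured by \<open>S\<close>, at the price of one
  point for each colour outside \<open>S\<close>. The theorem is thus the deficiency version of a Hall theorem:
  if for every set \<open>S\<close> of colours the vertices coloured by \<open>S\<close> have domination number at least
  \<open>card S\<close>, then there is an independent set using every colour exactly once.

  The usual topological proof of such a theorem can be carried out with mod 2 chains of independent
  sets. In a chordal graph every cycle of sets of size less than the domination number is a boundary.
  This permits choosing, for each \<open>S\<close>, a chain \<open>C S\<close> of independent sets with colours in \<open>S\<close> whose
  boundary is the sum of the chains \<open>C (S - {s})\<close>; counting facets as in Sperner's lemma shows
  that the number of rainbow sets in \<open>C S\<close> is odd.
\<close>

section \<open>Mod 2 chains of independent sets\<close>

declare add_bit_eq_xor [simp del] mult_bit_eq_and [simp del]

lemma bit_add_self: "x + x = (0::bit)"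
  by (cases x) simp_all

lemma bit_add_eq_0_iff: "x + y = 0 \<longleftrightarrow> x = y" for x y :: bit
  by (cases x; cases y) simp_all

text \<open>The simplicial boundary read coefficientwise: \<open>\<sigma>\<close> collects the sets
  of which it is a facet. The empty set counts as a face, so the complex is augmented.
  \<open>V\<close> stays fixed while chains move to smaller vertex sets.\<close>

definition bdry :: "'v set \<Rightarrow> ('v set \<Rightarrow> bit) \<Rightarrow> 'v set \<Rightarrow> bit" where
  "bdry V c \<sigma> = (\<Sum>v\<in>V - \<sigma>. c (insert v \<sigma>))"

text \<open>The join with apex \<open>v\<close>; only the values of \<open>c\<close> on sets
  avoiding \<open>v\<close> enter.\<close>

definition cone :: "'v \<Rightarrow> ('v set \<Rightarrow> bit) \<Rightarrow> 'v set \<Rightarrow> bit" where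
  "cone v c \<sigma> = (if v \<in> \<sigma> then c (\<sigma> - {v}) else 0)"

definition independent :: "('v \<Rightarrow> 'v \<Rightarrow> bool) \<Rightarrow> 'v set \<Rightarrow> bool" where
  "independent adj \<sigma> \<longleftrightarrow> (\<forall>a\<in>\<sigma>. \<forall>b\<in>\<sigma>. a \<noteq> b \<longrightarrow> \<not> adj a b)"

text \<open>\<open>k\<close> counts vertices; the dimension is one less.\<close>

definition chain :: "('v \<Rightarrow> 'v \<Rightarrow> bool) \<Rightarrow> 'v set \<Rightarrow> nat \<Rightarrow> ('v set \<Rightarrow> bit) \<Rightarrow> bool" where
  "chain adj W k c \<longleftrightarrow> (\<forall>\<sigma>. c \<sigma> \<noteq> 0 \<longrightarrow> \<sigma> \<subseteq> W \<and> card \<sigma> = k \<and> independent adj \<sigma>)"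

definition dominating :: "('v \<Rightarrow> 'v \<Rightarrow> bool) \<Rightarrow> 'v set \<Rightarrow> 'v set \<Rightarrow> bool" where
  "dominating adj W D \<longleftrightarrow> D \<subseteq> W \<and> (\<forall>w\<in>W. \<exists>d\<in>D. adj d w)"

definition simplicial :: "('v \<Rightarrow> 'v \<Rightarrow> bool) \<Rightarrow> 'v set \<Rightarrow> 'v \<Rightarrow> bool" where
  "simplicial adj W v \<longleftrightarrow> v \<in> W \<and> (\<forall>a\<in>W. \<forall>b\<in>W. adj v a \<longrightarrow> adj v b \<longrightarrow> adj a b)"

lemma bdry_add: "bdry V (\<lambda>\<sigma>. c \<sigma> + d \<sigma>) \<sigma> = bdry V c \<sigma> + bdry V d \<sigma>"
  by (simp add: bdry_def sum.distrib)

lemma bdry_sum: "bdry V (\<lambda>\<sigma>. \<Sum>i\<in>I. c i \<sigma>) \<sigma> = (\<Sum>i\<in>I. bdry V (c i) \<sigma>)"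
  unfolding bdry_def by (rule sum.swap)

text \<open>If \<open>v\<close> is in \<open>\<sigma>\<close>, the cone omits just the term for
  \<open>v\<close> from the boundary of \<open>c\<close> at \<open>\<sigma> - {v}\<close>; that term
  is \<open>c \<sigma>\<close>, and mod 2 omitting is adding. Otherwise \<open>v\<close> is the only
  extension that contributes.\<close>

lemma bdry_cone:
  assumes "finite V" "v \<in> V"
  shows "bdry V (cone v c) \<sigma> = (if v \<in> \<sigma> then bdry V c (\<sigma> - {v}) + c \<sigma> else c \<sigma>)"
proof (cases "v \<in> \<sigma>")
  case False
  have "bdry V (cone v c) \<sigma> = (\<Sum>a\<in>V - \<sigma>. if a = v then c \<sigma> else 0)"
    unfolding bdry_def using False by (intro sum.cong) (auto simp: cone_def)
  then show ?thesis
    using assms False by simp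
next
  case True
  have ins: "insert v (\<sigma> - {v}) = \<sigma>"
    using True by auto
  have "V - (\<sigma> - {v}) = insert v (V - \<sigma>)"
    using assms True by auto
  then have "bdry V c (\<sigma> - {v}) = c \<sigma> + (\<Sum>a\<in>V - \<sigma>. c (insert a (\<sigma> - {v})))"
    unfolding bdry_def using assms True ins by simp
  moreover have "(\<Sum>a\<in>V - \<sigma>. c (insert a (\<sigma> - {v}))) = bdry V (cone v c) \<sigma>"
    unfolding bdry_def cone_def
    using True by (intro sum.cong) (auto intro!: arg_cong[of _ _ c])
  ultimately show ?thesis
    using True by (simp add: ac_simps bit_add_self flip: add.assoc)
qed

lemma chain_add:
  "chain adj W k c \<Longrightarrow> chain adj W k d \<Longrightarrow> chain adj W k (\<lambda>\<sigma>. c \<sigma> + d \<sigma>)"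
  unfolding chain_def by (metis add_0)

lemma chain_mono: "chain adj U k c \<Longrightarrow> U \<subseteq> W \<Longrightarrow> chain adj W k c"
  unfolding chain_def by blast

lemma chain_sum:
  assumes "\<And>i. i \<in> I \<Longrightarrow> chain adj W k (c i)"
  shows "chain adj W k (\<lambda>\<sigma>. \<Sum>i\<in>I. c i \<sigma>)"
  using assms unfolding chain_def by (metis (no_types, lifting) sum.neutral)

lemma chain_cone:
  assumes "chain adj U k c" "finite U" "u \<notin> U" "\<And>a. a \<in> U \<Longrightarrow> \<not> adj u a \<and> \<not> adj a u"
  shows "chain adj (insert u U) (Suc k) (cone u c)"
  unfolding chain_def
proof (intro allI impI)
  fix \<sigma> assume "cone u c \<sigma> \<noteq> 0"
  then have u: "u \<in> \<sigma>" and "c (\<sigma> - {u}) \<noteq> 0"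
    by (auto simp: cone_def split: if_splits)
  then have *: "\<sigma> - {u} \<subseteq> U" "card (\<sigma> - {u}) = k" "independent adj (\<sigma> - {u})"
    using assms(1) unfolding chain_def by auto
  then have "finite \<sigma>"
    using assms(2) finite_subset by fastforce
  then have "card \<sigma> = Suc k"
    using * u by (metis card.remove)
  moreover have "independent adj \<sigma>"
    using * assms(4) unfolding independent_def by blast
  ultimately show "\<sigma> \<subseteq> insert u U \<and> card \<sigma> = Suc k \<and> independent adj \<sigma>"
    using * by auto
qed

text \<open>The boundary of the cone is \<open>c\<close> plus the cone over the boundary of
  \<open>c\<close>, and the latter vanishes.\<close>

lemma cycle_at_apex_bounds:
  assumes "finite V" "W \<subseteq> V" "v \<in> W" "chain adj W k c" "bdry V c = (\<lambda>_. 0)"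
    and indep: "\<And>\<sigma>. c \<sigma> \<noteq> 0 \<Longrightarrow> independent adj (insert v \<sigma>)"
  shows "\<exists>b. chain adj W (Suc k) b \<and> bdry V b = c"
proof (intro exI conjI)
  show "chain adj W (Suc k) (cone v c)"
    unfolding chain_def
  proof (intro allI impI)
    fix \<sigma> assume "cone v c \<sigma> \<noteq> 0"
    then have v: "v \<in> \<sigma>" and c: "c (\<sigma> - {v}) \<noteq> 0"
      by (auto simp: cone_def split: if_splits)
    then have *: "\<sigma> - {v} \<subseteq> W" "card (\<sigma> - {v}) = k"
      using assms(4) unfolding chain_def by auto
    then have "finite \<sigma>"
      using assms(1,2) finite_subset by (metis finite_Diff2 finite.emptyI finite.insertI)
    then have "card \<sigma> = Suc k"
      using * v by (metis card.remove)
    moreover have "independent adj \<sigma>"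
      using indep[OF c] v by (simp add: insert_absorb)
    ultimately show "\<sigma> \<subseteq> W \<and> card \<sigma> = Suc k \<and> independent adj \<sigma>"
      using * assms(3) by auto
  qed
  show "bdry V (cone v c) = c"
    using bdry_cone[of V v c] assms by (auto simp: fun_eq_iff)
qed

text \<open>Combinatorial form of: the independence complex of a chordal graph with domination number
  \<open>\<gamma>\<close> is homologically \<open>(\<gamma> - 2)\<close>-connected. If \<open>u\<close> is a neighbour of a simplicial vertex,
  then deleting \<open>u\<close> does not decrease \<open>\<gamma>\<close>, and deleting the closed neighbourhood of \<open>u\<close>
  decreases it by at most one.\<close>

lemma chordal_cycle_bounds:
  assumes "finite V" "reflp adj" "symp adj"
    and "W \<subseteq> V"
    and "\<And>U. U \<subseteq> W \<Longrightarrow> U \<noteq> {} \<Longrightarrow> \<exists>v. simplicial adj U v"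
    and "\<And>D. dominating adj W D \<Longrightarrow> k < card D"
    and "chain adj W k c" "bdry V c = (\<lambda>_. 0)"
  shows "\<exists>b. chain adj W (Suc k) b \<and> bdry V b = c"
  using assms(4-)
proof (induction "card W" arbitrary: W k c rule: less_induct)
  case less
  have finW: "finite W"
    using assms(1) less.prems(1) finite_subset by blast
  have "W \<noteq> {}"
    using less.prems(3)[of "{}"] by (auto simp: dominating_def)
  then obtain v where v: "simplicial adj W v"
    using less.prems(2) by blast
  then have vW: "v \<in> W"
    by (simp add: simplicial_def)
  have sym: "adj a b \<Longrightarrow> adj b a" for a b
    using assms(3) by (rule sympD)
  have refl: "adj a a" for a
    using assms(2) by (rule reflpD)
  have IH: "\<exists>b. chain adj U (Suc j) b \<and> bdry V b = d"
    if "card U < card W" "U \<subseteq> W" "\<And>D. dominating adj U D \<Longrightarrow> j < card D"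
      "chain adj U j d" "bdry V d = (\<lambda>_. 0)" for U j d
  proof (rule less.hyps[OF that(1)])
    show "U \<subseteq> V"
      using that(2) less.prems(1) by (rule order.trans)
    show "\<exists>v. simplicial adj U' v" if "U' \<subseteq> U" "U' \<noteq> {}" for U'
      using that \<open>U \<subseteq> W\<close> by (intro less.prems(2)) auto
  qed (fact that)+
  show ?case
  proof (cases k)
    case 0
    \<comment> \<open>Only the empty face can occur, so any vertex can be the apex.\<close>
    have "\<sigma> = {}" if "c \<sigma> \<noteq> 0" for \<sigma>
      using that less.prems(4) finite_subset[OF _ finW] 0 unfolding chain_def
      by (metis card_0_eq)
    then have "independent adj (insert v \<sigma>)" if "c \<sigma> \<noteq> 0" for \<sigma>
      using that by (auto simp: independent_def)
    then show ?thesis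
      by (rule cycle_at_apex_bounds[OF assms(1) less.prems(1) vW less.prems(4,5)])
  next
    case (Suc l)
    show ?thesis
    proof (cases "\<exists>u\<in>W. u \<noteq> v \<and> adj v u")
      case False
      \<comment> \<open>\<open>v\<close> has no neighbour in \<open>W\<close> except itself, so it
        extends every independent set.\<close>
      then have "independent adj (insert v \<sigma>)" if "c \<sigma> \<noteq> 0" for \<sigma>
        using that less.prems(4) sym unfolding chain_def independent_def
        by (metis insert_iff subsetD)
      then show ?thesis
        by (rule cycle_at_apex_bounds[OF assms(1) less.prems(1) vW less.prems(4,5)])
    next
      case True
      then obtain u where u: "u \<in> W" "u \<noteq> v" "adj v u"
        by blast
      have uV: "u \<in> V"
        using u less.prems(1) by blast
      \<comment> \<open>Split \<open>c\<close> at \<open>u\<close>: \<open>lnk\<close> is its part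
        in the link of \<open>u\<close>, \<open>del\<close> its part avoiding \<open>u\<close>, and
        \<open>c\<close> is \<open>del\<close> plus the cone over \<open>lnk\<close>.\<close>
      define lnk where "lnk \<sigma> = (if u \<in> \<sigma> then 0 else c (insert u \<sigma>))" for \<sigma>
      define del where "del \<sigma> = (if u \<in> \<sigma> then 0 else c \<sigma>)" for \<sigma>
      define L where "L = {w \<in> W. \<not> adj u w}"
      have uL: "u \<notin> L"
        using refl by (simp add: L_def)
      have c_eq: "c = (\<lambda>\<sigma>. del \<sigma> + cone u lnk \<sigma>)"
        by (auto simp: fun_eq_iff del_def lnk_def cone_def insert_absorb)
      have "bdry V del \<sigma> + bdry V (cone u lnk) \<sigma> = 0" for \<sigma>
        using less.prems(5) c_eq bdry_add[of V del "cone u lnk"] by (metis (no_types))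
      then have eq: "bdry V del \<sigma> = bdry V (cone u lnk) \<sigma>" for \<sigma>
        by (simp add: bit_add_eq_0_iff)
      have del0: "bdry V del \<sigma> = 0" if "u \<in> \<sigma>" for \<sigma>
        using that by (simp add: bdry_def del_def)
      have del1: "bdry V del \<sigma> = lnk \<sigma>" if "u \<notin> \<sigma>" for \<sigma>
        using that eq bdry_cone[OF assms(1) uV] by simp
      have lnk0: "bdry V lnk \<sigma> = 0" for \<sigma>
      proof (cases "u \<in> \<sigma>")
        case True
        then show ?thesis
          by (simp add: bdry_def lnk_def)
      next
        case False
        then have "bdry V lnk \<sigma> + lnk (insert u \<sigma>) = 0"
          using bdry_cone[OF assms(1) uV, of lnk "insert u \<sigma>"] eq[of "insert u \<sigma>"] del0[of "insert u \<sigma>"]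
          by simp
        then show ?thesis
          by (simp add: lnk_def)
      qed
      have chL: "chain adj L l lnk"
        unfolding chain_def
      proof (intro allI impI)
        fix \<sigma> assume "lnk \<sigma> \<noteq> 0"
        then have n: "u \<notin> \<sigma>" and "c (insert u \<sigma>) \<noteq> 0"
          by (auto simp: lnk_def split: if_splits)
        then have *: "insert u \<sigma> \<subseteq> W" "card (insert u \<sigma>) = Suc l" "independent adj (insert u \<sigma>)"
          using less.prems(4) Suc unfolding chain_def by auto
        then have "finite \<sigma>"
          using finite_subset[OF *(1) finW] by simp
        moreover have "\<sigma> \<subseteq> L"
        proof
          fix w assume w: "w \<in> \<sigma>"
          then have "\<not> adj u w"
            using *(3) n unfolding independent_def by (metis insertCI)
          then show "w \<in> L"
            using *(1) w by (auto simp: L_def)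
        qed
        ultimately show "\<sigma> \<subseteq> L \<and> card \<sigma> = l \<and> independent adj \<sigma>"
          using * n unfolding independent_def by simp
      qed
      have domL: "l < card D" if "dominating adj L D" for D
      proof -
        have "dominating adj W (insert u D)"
          using that u(1) unfolding dominating_def L_def by auto
        then have "Suc l < card (insert u D)"
          using less.prems(3) Suc by blast
        moreover have "finite D"
          using that finite_subset[OF _ finW] unfolding dominating_def L_def by blast
        ultimately show ?thesis
          by (simp add: card_insert_if split: if_splits)
      qed
      have LW: "L \<subseteq> W"
        by (auto simp: L_def)
      have "card L < card W"
        using finW u(1) uL by (intro psubset_card_mono) (auto simp: L_def)
      then have "\<exists>y. chain adj L (Suc l) y \<and> bdry V y = lnk"
        by (rule IH[OF _ LW _ chL ext[OF lnk0]]) (rule domL)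
      then obtain y where y: "chain adj L (Suc l) y" "bdry V y = lnk"
        by blast
      have y0: "y \<sigma> = 0" if "u \<in> \<sigma>" for \<sigma>
        using y(1) uL that unfolding chain_def by blast
      \<comment> \<open>Away from \<open>u\<close> the boundary of \<open>del\<close> is
        \<open>lnk\<close>, so adding the filling \<open>y\<close> of \<open>lnk\<close> yields a
        cycle that avoids \<open>u\<close>.\<close>
      have chD: "chain adj (W - {u}) k (\<lambda>\<sigma>. del \<sigma> + y \<sigma>)"
      proof (rule chain_add)
        show "chain adj (W - {u}) k del"
          using less.prems(4) unfolding chain_def del_def by auto
        show "chain adj (W - {u}) k y"
          using y(1) Suc uL by (auto simp: L_def intro: chain_mono)
      qed
      have cycD: "bdry V (\<lambda>\<sigma>. del \<sigma> + y \<sigma>) = (\<lambda>_. 0)"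
      proof
        fix \<sigma>
        show "bdry V (\<lambda>\<sigma>. del \<sigma> + y \<sigma>) \<sigma> = 0"
          unfolding bdry_add y(2)
          by (cases "u \<in> \<sigma>") (simp_all add: del0 del1 lnk_def bit_add_self)
      qed
      \<comment> \<open>Some \<open>d\<close> in \<open>D\<close> dominates \<open>v\<close>; as
        \<open>v\<close> is simplicial, \<open>d\<close> is also adjacent to its neighbour
        \<open>u\<close>, so \<open>D\<close> dominates \<open>W\<close>.\<close>
      have domD: "k < card D" if D: "dominating adj (W - {u}) D" for D
      proof -
        have "v \<in> W - {u}"
          using vW u(2) by blast
        then obtain d where d: "d \<in> D" "adj d v"
          using D unfolding dominating_def by blast
        moreover have "d \<in> W"
          using d(1) D unfolding dominating_def by blast
        ultimately have "adj d u"
          using v u sym unfolding simplicial_def by blast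
        then have "dominating adj W D"
          using D d unfolding dominating_def by blast
        then show ?thesis
          by (rule less.prems(3))
      qed
      have "card (W - {u}) < card W"
        using finW u(1) by (rule card_Diff1_less)
      then have "\<exists>x. chain adj (W - {u}) (Suc k) x \<and> bdry V x = (\<lambda>\<sigma>. del \<sigma> + y \<sigma>)"
        by (rule IH[OF _ Diff_subset _ chD cycD]) (rule domD)
      then obtain x where x: "chain adj (W - {u}) (Suc k) x" "bdry V x = (\<lambda>\<sigma>. del \<sigma> + y \<sigma>)"
        by blast
      have "chain adj (insert u L) (Suc (Suc l)) (cone u y)"
        using y(1) uL finW sym by (intro chain_cone) (auto simp: L_def)
      then have "chain adj W (Suc k) (cone u y)"
        unfolding Suc by (rule chain_mono) (use u(1) in \<open>auto simp: L_def\<close>)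
      moreover have "chain adj W (Suc k) x"
        using x(1) by (rule chain_mono) blast
      ultimately have "chain adj W (Suc k) (\<lambda>\<sigma>. x \<sigma> + cone u y \<sigma>)"
        by (simp add: chain_add)
      \<comment> \<open>The boundary of \<open>x\<close> is \<open>del\<close> plus
        \<open>y\<close>, and that of the cone is \<open>y\<close> plus the cone over
        \<open>lnk\<close>; the two copies of \<open>y\<close> cancel.\<close>
      moreover have "bdry V (\<lambda>\<sigma>. x \<sigma> + cone u y \<sigma>) = c"
      proof
        fix \<sigma>
        show "bdry V (\<lambda>\<sigma>. x \<sigma> + cone u y \<sigma>) \<sigma> = c \<sigma>"
        proof (cases "u \<in> \<sigma>")
          case True
          then show ?thesis
            unfolding bdry_add x(2) bdry_cone[OF assms(1) uV] y(2)
            by (simp add: y0 del_def lnk_def insert_absorb)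
        next
          case False
          then show ?thesis
            unfolding bdry_add x(2) bdry_cone[OF assms(1) uV] y(2)
            by (simp add: del_def add.assoc bit_add_self)
        qed
      qed
      ultimately show ?thesis
        by blast
    qed
  qed
qed

section \<open>Rainbow independent sets in chordal graphs\<close>

text \<open>Each unordered pair is counted twice. The use is the vanishing of boundaries of
  boundaries.\<close>

lemma sum_off_diagonal_symmetric:
  fixes f :: "'a \<Rightarrow> 'a \<Rightarrow> bit"
  assumes "finite A" "\<And>a b. f a b = f b a"
  shows "(\<Sum>a\<in>A. \<Sum>b\<in>A - {a}. f a b) = 0"
  using assms(1)
proof induction
  case (insert x A)
  have "(\<Sum>a\<in>A. \<Sum>b\<in>insert x A - {a}. f a b) = (\<Sum>a\<in>A. f a x + (\<Sum>b\<in>A - {a}. f a b))"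
  proof (rule sum.cong)
    fix a assume "a \<in> A"
    then have "insert x A - {a} = insert x (A - {a})"
      using insert.hyps by auto
    then show "(\<Sum>b\<in>insert x A - {a}. f a b) = f a x + (\<Sum>b\<in>A - {a}. f a b)"
      using insert.hyps by simp
  qed simp
  also have "\<dots> = (\<Sum>a\<in>A. f x a)"
    using insert.IH assms(2)[of _ x] by (simp add: sum.distrib)
  finally show ?case
    using insert.hyps by (simp add: bit_add_self)
qed simp

text \<open>One chain for each colour set \<open>S\<close>; as \<open>S\<close> varies they form a chain map from the full
  simplex on the colours.\<close>

definition coherent :: "'v set \<Rightarrow> ('v \<Rightarrow> 'v \<Rightarrow> bool) \<Rightarrow> ('v \<Rightarrow> 'x) \<Rightarrow> ('x set \<Rightarrow> 'v set \<Rightarrow> bit) \<Rightarrow> 'x set \<Rightarrow> bool"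
  where "coherent V adj col C S \<longleftrightarrow> chain adj {v \<in> V. col v \<in> S} (card S) (C S) \<and>
    bdry V (C S) = (\<lambda>\<sigma>. \<Sum>s\<in>S. C (S - {s}) \<sigma>)"

text \<open>Chains are chosen by increasing \<open>card S\<close>. The prescribed boundary is a
  cycle because removing two colours does not depend on their order, and the domination hypothesis
  lets \<open>chordal_cycle_bounds\<close> fill it.\<close>

lemma coherent_chains_exist:
  assumes "finite V" "reflp adj" "symp adj" "finite X"
    and "\<And>U. U \<subseteq> V \<Longrightarrow> U \<noteq> {} \<Longrightarrow> \<exists>v. simplicial adj U v"
    and "\<And>S D. S \<subseteq> X \<Longrightarrow> dominating adj {v \<in> V. col v \<in> S} D \<Longrightarrow> card S \<le> card D"
  shows "\<exists>C. C {} {} = 1 \<and> (\<forall>S\<subseteq>X. coherent V adj col C S)"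
proof -
  have "\<exists>C. C {} {} = 1 \<and> (\<forall>S\<subseteq>X. card S \<le> n \<longrightarrow> coherent V adj col C S)" for n
  proof (induction n)
    case 0
    \<comment> \<open>Only \<open>C {}\<close> matters here: the empty face with coefficient
      1.\<close>
    define C :: "'b set \<Rightarrow> 'a set \<Rightarrow> bit" where "C S \<sigma> = (if \<sigma> = {} then 1 else 0)" for S \<sigma>
    have "coherent V adj col C {}"
      by (auto simp: coherent_def chain_def C_def independent_def bdry_def fun_eq_iff)
    moreover have "S = {}" if "S \<subseteq> X" "card S \<le> 0" for S
      using that assms(4) finite_subset by fastforce
    moreover have "C {} {} = 1"
      by (simp add: C_def)
    ultimately show ?case
      by metis
  next
    case (Suc n)
    then obtain C where C0: "C {} {} = 1"
      and C: "\<And>S. S \<subseteq> X \<Longrightarrow> card S \<le> n \<Longrightarrow> coherent V adj col C S"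
      by blast
    have ex: "\<exists>b. chain adj {v \<in> V. col v \<in> S} (Suc n) b \<and> bdry V b = (\<lambda>\<sigma>. \<Sum>s\<in>S. C (S - {s}) \<sigma>)"
      if S: "S \<subseteq> X" "card S = Suc n" for S
    proof (rule chordal_cycle_bounds[OF assms(1-3)])
      have fS: "finite S"
        using S(1) assms(4) by (rule finite_subset)
      have cS: "coherent V adj col C (S - {s})" if "s \<in> S" for s
        using that S fS by (intro C) auto
      show "chain adj {v \<in> V. col v \<in> S} n (\<lambda>\<sigma>. \<Sum>s\<in>S. C (S - {s}) \<sigma>)"
      proof (rule chain_sum)
        fix s assume s: "s \<in> S"
        then have "chain adj {v \<in> V. col v \<in> S - {s}} n (C (S - {s}))"
          using cS[OF s] S(2) fS by (simp add: coherent_def)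
        then show "chain adj {v \<in> V. col v \<in> S} n (C (S - {s}))"
          by (rule chain_mono) auto
      qed
      have "(\<Sum>s\<in>S. bdry V (C (S - {s})) \<sigma>) = 0" for \<sigma>
      proof -
        have "(\<Sum>s\<in>S. bdry V (C (S - {s})) \<sigma>) = (\<Sum>s\<in>S. \<Sum>t\<in>S - {s}. C (S - {s} - {t}) \<sigma>)"
          using cS by (intro sum.cong) (auto simp: coherent_def)
        also have "\<dots> = 0"
          by (rule sum_off_diagonal_symmetric[OF fS]) (metis Diff_insert insert_commute)
        finally show ?thesis .
      qed
      then show "bdry V (\<lambda>\<sigma>. \<Sum>s\<in>S. C (S - {s}) \<sigma>) = (\<lambda>_. 0)"
        by (simp add: fun_eq_iff bdry_sum)
      show "n < card D" if "dominating adj {v \<in> V. col v \<in> S} D" for D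
        using assms(6)[OF S(1) that] S(2) by simp
      show "{v \<in> V. col v \<in> S} \<subseteq> V"
        by blast
      show "\<exists>v. simplicial adj U v" if "U \<subseteq> {v \<in> V. col v \<in> S}" "U \<noteq> {}" for U
        using that by (intro assms(5)) auto
    qed
    define B where "B S = (SOME b. chain adj {v \<in> V. col v \<in> S} (Suc n) b \<and>
        bdry V b = (\<lambda>\<sigma>. \<Sum>s\<in>S. C (S - {s}) \<sigma>))" for S
    have B: "chain adj {v \<in> V. col v \<in> S} (Suc n) (B S) \<and>
        bdry V (B S) = (\<lambda>\<sigma>. \<Sum>s\<in>S. C (S - {s}) \<sigma>)" if "S \<subseteq> X" "card S = Suc n" for S
      unfolding B_def by (rule someI_ex[OF ex[OF that]])
    \<comment> \<open>Only sets of size \<open>Suc n\<close> are redefined, so the chains entering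
      the prescribed boundaries do not change.\<close>
    define C' where "C' S = (if card S = Suc n then B S else C S)" for S
    have "coherent V adj col C' S" if S: "S \<subseteq> X" "card S \<le> Suc n" for S
    proof -
      have "C' (S - {s}) = C (S - {s})" if "s \<in> S" for s
      proof -
        have "card (S - {s}) < card S"
          using finite_subset[OF S(1) assms(4)] that by (rule card_Diff1_less)
        then show ?thesis
          using S(2) by (simp add: C'_def)
      qed
      then have eq: "(\<lambda>\<sigma>. \<Sum>s\<in>S. C' (S - {s}) \<sigma>) = (\<lambda>\<sigma>. \<Sum>s\<in>S. C (S - {s}) \<sigma>)"
        by simp
      show ?thesis
      proof (cases "card S = Suc n")
        case True
        then show ?thesis
          unfolding coherent_def eq using B[OF S(1)] by (simp add: C'_def)
      next
        case False
        then show ?thesis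
          using C[OF S(1)] S(2) unfolding coherent_def eq by (simp add: C'_def)
      qed
    qed
    moreover have "C' {} {} = 1"
      by (simp add: C'_def C0)
    ultimately show ?case
      by blast
  qed
  from this[of "card X"] show ?thesis
    using card_mono[OF assms(4)] by blast
qed

section \<open>Sperner counting mod 2\<close>

lemma of_nat_bit: "(of_nat n :: bit) = of_bool (odd n)"
  by (induction n) (simp_all add: bit_add_self)

text \<open>The count behind Sperner's lemma: facets coloured exactly by \<open>S\<close> come in a pair if the colours
  are only \<open>S\<close>.\<close>

lemma facet_parity:
  fixes col :: "'v \<Rightarrow> 'x"
  assumes "finite \<tau>" "card \<tau> = Suc (card S)" "s \<notin> S" "finite S" "col ` \<tau> \<subseteq> insert s S"
  shows "(\<Sum>v\<in>\<tau>. of_bool (col ` (\<tau> - {v}) = S)) = (of_bool (col ` \<tau> = insert s S) :: bit)"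
proof -
  let ?E = "{v \<in> \<tau>. col ` (\<tau> - {v}) = S}"
  consider "col ` \<tau> = insert s S" | "col ` \<tau> = S" | "col ` \<tau> \<noteq> insert s S" "col ` \<tau> \<noteq> S"
    by blast
  then have "odd (card ?E) \<longleftrightarrow> col ` \<tau> = insert s S"
  proof cases
    case 1
    then have inj: "inj_on col \<tau>"
      using assms by (intro eq_card_imp_inj_on) auto
    obtain v where v: "v \<in> \<tau>" "col v = s"
      using 1 by (metis imageE insertI1)
    have "col ` (\<tau> - {w}) = insert s S - {col w}" if "w \<in> \<tau>" for w
      using inj_on_image_set_diff[OF inj, of \<tau> "{w}"] that 1 by simp
    then have "?E = {v}"
      using v assms(3) inj 1 by (auto simp: inj_on_def)
    then show ?thesis
      using 1 by simp
  next
    case 2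
    then have "\<not> inj_on col \<tau>"
      using assms(2) card_image by fastforce
    then obtain a b where ab: "a \<in> \<tau>" "b \<in> \<tau>" "a \<noteq> b" "col a = col b"
      unfolding inj_on_def by blast
    have drop: "col ` (A - {x}) = col ` A" if "y \<in> A - {x}" "col y = col x" for A x y
    proof -
      have "col ` A \<subseteq> insert (col x) (col ` (A - {x}))"
        by blast
      moreover have "col x \<in> col ` (A - {x})"
        using imageI[OF that(1), of col] that(2) by simp
      ultimately show ?thesis
        by blast
    qed
    have a: "col ` (\<tau> - {a}) = S" and b: "col ` (\<tau> - {b}) = S"
      using drop[of b \<tau> a] drop[of a \<tau> b] ab 2 by simp_all
    \<comment> \<open>Removing a third vertex leaves \<open>a\<close> and \<open>b\<close> with one
      colour, hence fewer than \<open>card S\<close> colours.\<close>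
    have "w \<in> {a, b}" if w: "w \<in> ?E" for w
    proof (rule ccontr)
      assume "w \<notin> {a, b}"
      then have "col ` (\<tau> - {w}) = col ` (\<tau> - {w} - {a})"
        using ab by (intro drop[of b, symmetric]) auto
      then have "card S \<le> card (\<tau> - {w} - {a})"
        using w assms(1) by (metis (mono_tags, lifting) card_image_le finite_Diff mem_Collect_eq)
      moreover have "card (\<tau> - {w} - {a}) < card (\<tau> - {w})"
        using ab \<open>w \<notin> {a, b}\<close> assms(1) by (intro card_Diff1_less) auto
      moreover have "card (\<tau> - {w}) = card S"
        using w assms(1,2) by simp
      ultimately show False
        by simp
    qed
    then have "?E = {a, b}"
      using ab a b by blast
    then show ?thesis
      using ab 2 assms(3) by auto
  next
    case 3
    have "?E = {}"
    proof (rule ccontr)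
      assume "?E \<noteq> {}"
      then obtain v where v: "v \<in> \<tau>" "col ` (\<tau> - {v}) = S"
        by blast
      then have "col ` \<tau> = insert (col v) S"
        by auto
      moreover have "col v \<in> insert s S"
        using v(1) assms(5) by blast
      ultimately show False
        using 3 by auto
    qed
    then show ?thesis
      using 3 by (metis card.empty even_zero)
  qed
  then show ?thesis
    using assms(1) by (simp add: of_nat_bit Int_def)
qed

text \<open>Induction adding a colour \<open>s\<close>: count mod 2 the facets with colour set
  \<open>S\<close> of members of \<open>C (insert s S)\<close>. By \<open>facet_parity\<close> this
  counts the members using all of \<open>insert s S\<close>; by coherence it counts the members of
  \<open>C S\<close> using all of \<open>S\<close>.\<close>

lemma rainbow_parity:
  fixes col :: "'v \<Rightarrow> 'x"
  assumes "finite V" "finite X" "S \<subseteq> X" "C {} {} = 1" "\<And>S. S \<subseteq> X \<Longrightarrow> coherent V adj col C S"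
  shows "(\<Sum>\<tau>\<in>Pow V. of_bool (col ` \<tau> = S) * C S \<tau>) = 1"
proof -
  have "finite S"
    using assms(2,3) finite_subset by blast
  then show ?thesis
    using assms(3)
  proof (induction S)
    case empty
    have "(\<Sum>\<tau>\<in>Pow V. of_bool (col ` \<tau> = {}) * C {} \<tau>) = (\<Sum>\<tau>\<in>Pow V. if \<tau> = {} then C {} {} else 0)"
      by (intro sum.cong) auto
    then show ?case
      using assms(1,4) by simp
  next
    case (insert s S)
    let ?T = "insert s S"
    have T: "chain adj {v \<in> V. col v \<in> ?T} (card ?T) (C ?T)"
      "bdry V (C ?T) = (\<lambda>\<sigma>. \<Sum>t\<in>?T. C (?T - {t}) \<sigma>)"
      using assms(5)[OF insert.prems] by (auto simp: coherent_def)
    \<comment> \<open>Trades pairs of a facet and an added vertex for pairs of a set and a removed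
      vertex.\<close>
    have facets: "bij_betw (\<lambda>(\<sigma>, v). (insert v \<sigma>, v)) (SIGMA \<sigma>:Pow V. V - \<sigma>) (SIGMA \<tau>:Pow V. \<tau>)"
      by (rule bij_betw_byWitness[where f' = "\<lambda>(\<tau>, v). (\<tau> - {v}, v)"]) auto
    have "(\<Sum>\<sigma>\<in>Pow V. of_bool (col ` \<sigma> = S) * bdry V (C ?T) \<sigma>) =
        (\<Sum>(\<sigma>, v)\<in>(SIGMA \<sigma>:Pow V. V - \<sigma>). of_bool (col ` \<sigma> = S) * C ?T (insert v \<sigma>))"
      unfolding bdry_def sum_distrib_left using assms(1) by (subst sum.Sigma) auto
    also have "\<dots> = (\<Sum>(\<tau>, v)\<in>(SIGMA \<tau>:Pow V. \<tau>). of_bool (col ` (\<tau> - {v}) = S) * C ?T \<tau>)"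
      by (rule trans[OF _ sum.reindex_bij_betw[OF facets]]) (auto intro!: sum.cong)
    also have "\<dots> = (\<Sum>\<tau>\<in>Pow V. (\<Sum>v\<in>\<tau>. of_bool (col ` (\<tau> - {v}) = S)) * C ?T \<tau>)"
      unfolding sum_distrib_right using assms(1) by (subst sum.Sigma) (auto intro: finite_subset)
    also have "\<dots> = (\<Sum>\<tau>\<in>Pow V. of_bool (col ` \<tau> = ?T) * C ?T \<tau>)"
    proof (rule sum.cong)
      fix \<tau> assume "\<tau> \<in> Pow V"
      show "(\<Sum>v\<in>\<tau>. of_bool (col ` (\<tau> - {v}) = S)) * C ?T \<tau> = of_bool (col ` \<tau> = ?T) * C ?T \<tau>"
      proof (cases "C ?T \<tau> = 0")
        case False
        then have "col ` \<tau> \<subseteq> ?T" "card \<tau> = Suc (card S)"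
          using T(1) insert.hyps unfolding chain_def by auto
        moreover have "finite \<tau>"
          using \<open>\<tau> \<in> Pow V\<close> assms(1) finite_subset by auto
        ultimately show ?thesis
          by (subst facet_parity) (use insert.hyps in auto)
      qed simp
    qed simp
    finally have "(\<Sum>\<tau>\<in>Pow V. of_bool (col ` \<tau> = ?T) * C ?T \<tau>) =
        (\<Sum>\<sigma>\<in>Pow V. of_bool (col ` \<sigma> = S) * bdry V (C ?T) \<sigma>)"
      by (rule sym)
    also have "\<dots> = (\<Sum>\<sigma>\<in>Pow V. of_bool (col ` \<sigma> = S) * C S \<sigma>)"
    proof (rule sum.cong)
      fix \<sigma>
      \<comment> \<open>Sets in this chain lack the colour \<open>t\<close>, so only the summand
        \<open>C S\<close> of the boundary survives.\<close>
      have "C (?T - {t}) \<sigma> = 0" if "t \<in> S" "col ` \<sigma> = S" for t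
      proof (rule ccontr)
        assume "C (?T - {t}) \<sigma> \<noteq> 0"
        moreover have "coherent V adj col C (?T - {t})"
          using insert.prems by (intro assms(5)) auto
        ultimately have "\<sigma> \<subseteq> {v \<in> V. col v \<in> ?T - {t}}"
          unfolding coherent_def chain_def by blast
        then show False
          using that by auto
      qed
      then show "of_bool (col ` \<sigma> = S) * bdry V (C ?T) \<sigma> = of_bool (col ` \<sigma> = S) * C S \<sigma>"
        unfolding T(2) using insert.hyps by simp
    qed simp
    finally show ?case
      using insert.IH insert.prems by simp
  qed
qed

text \<open>An odd count is nonzero, and a set in \<open>C X\<close> has \<open>card X\<close>
  elements, so using all colours it repeats none.\<close>

lemma chordal_rainbow_independent:
  fixes col :: "'v \<Rightarrow> 'x"
  assumes "finite V" "reflp adj" "symp adj" "finite X"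
    and "\<And>U. U \<subseteq> V \<Longrightarrow> U \<noteq> {} \<Longrightarrow> \<exists>v. simplicial adj U v"
    and "\<And>S D. S \<subseteq> X \<Longrightarrow> dominating adj {v \<in> V. col v \<in> S} D \<Longrightarrow> card S \<le> card D"
  obtains \<sigma> where "\<sigma> \<subseteq> V" "independent adj \<sigma>" "bij_betw col \<sigma> X"
proof -
  obtain C where C: "C {} {} = 1" "\<And>S. S \<subseteq> X \<Longrightarrow> coherent V adj col C S"
    using coherent_chains_exist[OF assms, of col] by blast
  have "(\<Sum>\<tau>\<in>Pow V. of_bool (col ` \<tau> = X) * C X \<tau>) \<noteq> 0"
    using rainbow_parity[OF assms(1,4) order.refl C] by simp
  then obtain \<tau> where "\<tau> \<in> Pow V" "of_bool (col ` \<tau> = X) * C X \<tau> \<noteq> 0"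
    by (rule sum.not_neutral_contains_not_neutral)
  then have \<tau>: "\<tau> \<subseteq> V" "col ` \<tau> = X" "C X \<tau> \<noteq> 0"
    by (auto split: if_splits)
  then have "card \<tau> = card X" "independent adj \<tau>"
    using C(2)[OF order.refl] unfolding coherent_def chain_def by auto
  moreover have "inj_on col \<tau>"
    using \<tau> \<open>card \<tau> = card X\<close> assms(1) finite_subset by (intro eq_card_imp_inj_on) auto
  ultimately show ?thesis
    using that \<tau> by (simp add: bij_betw_def)
qed

section \<open>Subtrees of a tree\<close>

text \<open>Edges as a symmetric relation, so that walks become transitive closures and distances
  become relation powers.\<close>

definition arcs :: "'a ugraph \<Rightarrow> ('a \<times> 'a) set" where
  "arcs G = {(a, b). {a, b} \<in> edges G}"

lemma sym_arcs: "sym (arcs G)"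
  by (auto simp: sym_def arcs_def insert_commute)

lemma walk_imp_rtrancl: "walk G p \<Longrightarrow> (hd p, last p) \<in> (arcs G)\<^sup>*"
proof (induction p rule: rev_induct)
  case (snoc x xs)
  show ?case
  proof (cases "xs = []")
    case False
    have edge: "{(xs @ [x]) ! i, (xs @ [x]) ! Suc i} \<in> edges G" if "Suc i < length (xs @ [x])" for i
      using snoc.prems that unfolding walk_def by blast
    have "{xs ! i, xs ! Suc i} \<in> edges G" if "Suc i < length xs" for i
      using edge[of i] that by (simp add: nth_append)
    then have "walk G xs"
      using snoc.prems False by (simp add: walk_def)
    moreover have "{last xs, x} \<in> edges G"
      using edge[of "length xs - 1"] False by (simp add: nth_append last_conv_nth)
    ultimately show ?thesis
      using snoc.IH False by (auto simp: arcs_def intro: rtrancl_into_rtrancl)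
  qed simp
qed (simp add: walk_def)

text \<open>Extend the path step by step; if the new endpoint already occurs on it, cut the path
  there.\<close>

lemma rtrancl_imp_distinct_path:
  assumes "(a, b) \<in> R\<^sup>*"
  shows "\<exists>p. p \<noteq> [] \<and> hd p = a \<and> last p = b \<and> distinct p \<and>
    (\<forall>i. Suc i < length p \<longrightarrow> (p ! i, p ! Suc i) \<in> R)"
  using assms
proof induction
  case base
  show ?case
    by (intro exI[of _ "[a]"]) simp
next
  case (step b c)
  then obtain p where p: "p \<noteq> []" "hd p = a" "last p = b" "distinct p"
    "\<And>i. Suc i < length p \<Longrightarrow> (p ! i, p ! Suc i) \<in> R"
    by blast
  show ?case
  proof (cases "c \<in> set p")
    case True
    then obtain xs ys where xs: "p = (xs @ [c]) @ ys"
      using split_list by fastforce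
    have "((xs @ [c]) ! i, (xs @ [c]) ! Suc i) \<in> R" if "Suc i < length (xs @ [c])" for i
      using p(5)[of i] that unfolding xs nth_append[of "xs @ [c]" ys] by simp
    moreover have "hd (xs @ [c]) = a"
      using p(2) unfolding xs by (cases xs) auto
    ultimately show ?thesis
      using p(4) unfolding xs by (intro exI[of _ "xs @ [c]"]) auto
  next
    case False
    have "((p @ [c]) ! i, (p @ [c]) ! Suc i) \<in> R" if "Suc i < length (p @ [c])" for i
    proof (cases "Suc i < length p")
      case True
      then show ?thesis
        using p(5) by (simp add: nth_append)
    next
      case False
      then have "i = length p - 1"
        using that by simp
      then show ?thesis
        using p(1,3) step.hyps(2) by (simp add: nth_append last_conv_nth)
    qed
    then show ?thesis
      using p False by (intro exI[of _ "p @ [c]"]) auto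
  qed
qed

text \<open>A repetition-free path around the edge would close up with it to a cycle.\<close>

lemma tree_edge_is_bridge:
  assumes "tree T" "(a, b) \<in> arcs T"
  shows "(a, b) \<notin> (arcs T - {(a, b), (b, a)})\<^sup>*"
proof
  assume "(a, b) \<in> (arcs T - {(a, b), (b, a)})\<^sup>*"
  then obtain p where p: "p \<noteq> []" "hd p = a" "last p = b" "distinct p"
    "\<And>i. Suc i < length p \<Longrightarrow> (p ! i, p ! Suc i) \<in> arcs T - {(a, b), (b, a)}"
    using rtrancl_imp_distinct_path by metis
  have simple: "e \<subseteq> verts T \<and> card e = 2" if "e \<in> edges T" for e
    using assms(1) that unfolding tree_def simple_graph_def by blast
  have ab: "{a, b} \<in> edges T"
    using assms(2) by (simp add: arcs_def)
  have edge: "{p ! i, p ! Suc i} \<in> edges T" if "Suc i < length p" for i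
    using p(5)[OF that] by (simp add: arcs_def)
  have "a \<noteq> b"
    using simple[OF ab] by auto
  \<comment> \<open>A list of length 1 would give \<open>a = b\<close>, one of length 2 would be the
    removed arc itself.\<close>
  then have "length p \<noteq> 1"
    using p(1-3) by (metis One_nat_def hd_conv_nth last_conv_nth diff_self_eq_0)
  moreover have "length p \<noteq> 2"
  proof
    assume "length p = 2"
    then have "(p ! 0, p ! Suc 0) = (a, b)"
      using p(1-3) by (simp add: hd_conv_nth last_conv_nth)
    then show False
      using p(5)[of 0] \<open>length p = 2\<close> by simp
  qed
  moreover have "length p \<noteq> 0"
    using p(1) by simp
  ultimately have len: "3 \<le> length p"
    by linarith
  have "x \<in> verts T" if x: "x \<in> set p" for x
  proof -
    obtain i where i: "i < length p" "x = p ! i"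
      using x by (metis in_set_conv_nth)
    show ?thesis
    proof (cases i)
      case 0
      then show ?thesis
        using simple[OF edge[of 0]] len i by simp
    next
      case (Suc j)
      then show ?thesis
        using simple[OF edge[of j]] i by simp
    qed
  qed
  then have "cycle T p"
    unfolding cycle_def walk_def using p(1-4) len edge ab by (auto simp: insert_commute)
  then show False
    using assms(1) unfolding tree_def by blast
qed

section \<open>Depth below a root\<close>

definition depth :: "('a \<times> 'a) set \<Rightarrow> 'a \<Rightarrow> 'a \<Rightarrow> nat" where
  "depth R r v = (LEAST n. (r, v) \<in> R ^^ n)"

text \<open>For an unreachable \<open>v\<close> the value of \<open>depth\<close> is unspecified,
  hence the reachability assumptions here and below.\<close>

lemma relpow_depth:
  assumes "(r, v) \<in> R\<^sup>*"
  shows "(r, v) \<in> R ^^ depth R r v"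
proof -
  have "\<exists>n. (r, v) \<in> R ^^ n"
    using assms by (simp add: rtrancl_power)
  then show ?thesis
    unfolding depth_def by (rule LeastI_ex)
qed

lemma depth_le: "(r, v) \<in> R ^^ n \<Longrightarrow> depth R r v \<le> n"
  unfolding depth_def by (rule Least_le)

lemma depth_step_le:
  assumes "(r, v) \<in> R\<^sup>*" "(v, w) \<in> R"
  shows "depth R r w \<le> Suc (depth R r v)"
  by (rule depth_le[OF relpow_Suc_I[OF relpow_depth[OF assms(1)] assms(2)]])

lemma parent_exists:
  assumes "(r, v) \<in> R\<^sup>*" "depth R r v = Suc n"
  obtains p where "(r, p) \<in> R\<^sup>*" "(p, v) \<in> R" "depth R r p = n"
proof -
  have "(r, v) \<in> R ^^ Suc n"
    using relpow_depth[OF assms(1)] assms(2) by simp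
  then obtain p where p: "(r, p) \<in> R ^^ n" "(p, v) \<in> R"
    by (rule relpow_Suc_E)
  then have "(r, p) \<in> R\<^sup>*"
    by (simp add: relpow_imp_rtrancl)
  moreover have "depth R r p = n"
    using depth_le[OF p(1)] depth_step_le[OF \<open>(r, p) \<in> R\<^sup>*\<close> p(2)] assms(2) by simp
  ultimately show ?thesis
    using that p(2) by blast
qed

lemma depth_0_imp_root: "(r, v) \<in> R\<^sup>* \<Longrightarrow> depth R r v = 0 \<Longrightarrow> v = r"
  using relpow_depth[of r v R] by simp

text \<open>Follow parents back from \<open>v\<close>: the depth drops at each step. In
  \<open>unique_top\<close> this keeps such paths away from a given vertex.\<close>

lemma path_from_root:
  assumes "(r, v) \<in> R\<^sup>*"
  shows "(r, v) \<in> (Restr R {x. x = v \<or> depth R r x < depth R r v})\<^sup>*"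
  using assms
proof (induction "depth R r v" arbitrary: v)
  case 0
  then show ?case
    using depth_0_imp_root[of r v R] by simp
next
  case (Suc n)
  obtain p where p: "(r, p) \<in> R\<^sup>*" "(p, v) \<in> R" "depth R r p = n"
    using parent_exists[OF Suc.prems Suc.hyps(2)[symmetric]] .
  have "(r, p) \<in> (Restr R {x. x = p \<or> depth R r x < depth R r p})\<^sup>*"
    by (rule Suc.hyps(1)[OF p(3)[symmetric] p(1)])
  also have "\<dots> \<subseteq> (Restr R {x. x = v \<or> depth R r x < depth R r v})\<^sup>*"
    using p(3) Suc.hyps(2) by (intro rtrancl_mono) auto
  finally show ?case
    by (rule rtrancl_into_rtrancl) (use p(2,3) Suc.hyps(2)[symmetric] in simp)
qed

text \<open>Each component of the part of a tree at depth at least \<open>k\<close> hangs on a single vertex of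
  depth \<open>k\<close>: two of them would give, through the root, a detour around the edge from the first
  one to its parent.\<close>

lemma unique_top:
  assumes "sym R" and bridge: "\<And>a b. (a, b) \<in> R \<Longrightarrow> (a, b) \<notin> (R - {(a, b), (b, a)})\<^sup>*"
    and "(r, m) \<in> R\<^sup>*" "(r, m') \<in> R\<^sup>*" "depth R r m = k" "depth R r m' = k"
    and path: "(m, m') \<in> (Restr R {x. k \<le> depth R r x})\<^sup>*"
  shows "m = m'"
proof (cases k)
  case 0
  then show ?thesis
    using depth_0_imp_root[OF assms(3)] depth_0_imp_root[OF assms(4)] assms(5,6) by simp
next
  case (Suc n)
  show ?thesis
  proof (rule ccontr)
    assume "m \<noteq> m'"
    obtain p where p: "(r, p) \<in> R\<^sup>*" "(p, m) \<in> R" "depth R r p = n"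
      using parent_exists[OF assms(3)] assms(5) Suc by metis
    define Q where "Q = R - {(m, p), (p, m)}"
    have "sym Q"
      using assms(1) unfolding Q_def sym_def by blast
    then have symQ: "sym (Q\<^sup>*)"
      by (rule sym_rtrancl)
    \<comment> \<open>Three paths inside \<open>Q\<close>: the one from \<open>m\<close> to
      \<open>m'\<close> stays at depth at least \<open>k\<close> and misses \<open>p\<close>; those
      from \<open>r\<close> to \<open>m'\<close> and to \<open>p\<close> meet no vertex of depth
      \<open>k\<close> except \<open>m'\<close>, so they miss \<open>m\<close>.\<close>
    have "Restr R {x. k \<le> depth R r x} \<subseteq> Q"
      using p(3) Suc by (auto simp: Q_def)
    then have "(m, m') \<in> Q\<^sup>*"
      using path rtrancl_mono by blast
    moreover have "Restr R {x. x = m' \<or> depth R r x < depth R r m'} \<subseteq> Q"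
      using assms(5,6) \<open>m \<noteq> m'\<close> by (auto simp: Q_def)
    then have "(r, m') \<in> Q\<^sup>*"
      using path_from_root[OF assms(4)] rtrancl_mono by blast
    then have "(m', r) \<in> Q\<^sup>*"
      using symQ by (rule symD[rotated])
    moreover have "Restr R {x. x = p \<or> depth R r x < depth R r p} \<subseteq> Q"
      using assms(5) p(3) Suc by (auto simp: Q_def)
    then have "(r, p) \<in> Q\<^sup>*"
      using path_from_root[OF p(1)] rtrancl_mono by blast
    ultimately have "(m, p) \<in> Q\<^sup>*"
      by (meson rtrancl_trans)
    moreover have "(m, p) \<in> R"
      using p(2) assms(1) by (rule symD[rotated])
    ultimately show False
      using bridge unfolding Q_def by blast
  qed
qed

section \<open>Intersecting subtrees\<close>

lemma subtree_connected:
  assumes "subtree t T" "a \<in> verts t" "b \<in> verts t"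
  shows "(a, b) \<in> (Restr (arcs T) (verts t))\<^sup>*"
proof -
  have "tree t"
    using assms(1) by (simp add: subtree_def)
  then obtain p where "walk t p" "hd p = a" "last p = b"
    using assms(2,3) unfolding tree_def connected_graph_def by blast
  then have "(a, b) \<in> (arcs t)\<^sup>*"
    using walk_imp_rtrancl by blast
  moreover have "arcs t \<subseteq> Restr (arcs T) (verts t)"
    using assms(1) \<open>tree t\<close> unfolding subtree_def tree_def simple_graph_def arcs_def by auto
  ultimately show ?thesis
    using rtrancl_mono by blast
qed

lemma subtree_nonempty: "subtree t T \<Longrightarrow> verts t \<noteq> {}"
  by (simp add: subtree_def tree_def connected_graph_def)

text \<open>The tree is rooted arbitrarily, and the subtree chosen is one whose vertex nearest to the
  root is as deep as possible.\<close>

lemma subtrees_common_vertex: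
  assumes "tree T" "finite U" "U \<noteq> {}" and sub: "\<And>e. e \<in> U \<Longrightarrow> subtree (t e) T"
  shows "\<exists>e\<in>U. \<exists>m. \<forall>f\<in>U. verts (t e) \<inter> verts (t f) \<noteq> {} \<longrightarrow> m \<in> verts (t f)"
proof -
  have "connected_graph T"
    using assms(1) by (simp add: tree_def)
  then obtain r where r: "r \<in> verts T"
    by (auto simp: connected_graph_def)
  let ?R = "arcs T" and ?d = "depth (arcs T) r"
  have reach: "(r, v) \<in> ?R\<^sup>*" if "v \<in> verts (t e)" "e \<in> U" for v e
  proof -
    have "v \<in> verts T"
      using sub[OF that(2)] that(1) by (auto simp: subtree_def)
    then obtain p where "walk T p" "hd p = r" "last p = v"
      using \<open>connected_graph T\<close> r unfolding connected_graph_def by blast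
    then show ?thesis
      using walk_imp_rtrancl by blast
  qed
  \<comment> \<open>The distance of the subtree from the root, as a least number since subtrees may
    be infinite.\<close>
  define h where "h e = (LEAST n. n \<in> ?d ` verts (t e))" for e
  have h_attained: "\<exists>m\<in>verts (t e). ?d m = h e" if "e \<in> U" for e
  proof -
    have "\<exists>n. n \<in> ?d ` verts (t e)"
      using subtree_nonempty[OF sub[OF that]] by blast
    from LeastI_ex[OF this] have "h e \<in> ?d ` verts (t e)"
      by (simp only: h_def)
    then show ?thesis
      by auto
  qed
  have h_le: "h e \<le> ?d v" if "v \<in> verts (t e)" for e v
    unfolding h_def using that by (intro Least_le) simp
  have "Max (h ` U) \<in> h ` U"
    using assms(2,3) by (intro Max_in) auto
  then obtain e where e: "e \<in> U" "Max (h ` U) = h e"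
    by auto
  have h_max: "h f \<le> h e" if "f \<in> U" for f
    using Max_ge[of "h ` U" "h f"] assms(2) that e(2) by simp
  obtain m where m: "m \<in> verts (t e)" "?d m = h e"
    using h_attained[OF e(1)] by blast
  define D where "D = Restr ?R {x. h e \<le> ?d x}"
  have "m \<in> verts (t f)" if f: "f \<in> U" "verts (t e) \<inter> verts (t f) \<noteq> {}" for f
  proof -
    obtain w where w: "w \<in> verts (t e)" "w \<in> verts (t f)"
      using f(2) by blast
    obtain m' where m': "m' \<in> verts (t f)" "?d m' = h f"
      using h_attained[OF f(1)] by blast
    have "Restr ?R (verts (t e)) \<subseteq> D"
      using h_le unfolding D_def by auto
    then have mw: "(m, w) \<in> D\<^sup>*"
      using subtree_connected[OF sub[OF e(1)] m(1) w(1)] rtrancl_mono by blast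
    have "(w, m') \<in> (Restr ?R (verts (t f)))\<^sup>*"
      by (rule subtree_connected[OF sub[OF f(1)] w(2) m'(1)])
    \<comment> \<open>Along \<open>t f\<close> from \<open>w\<close> to \<open>m'\<close> the depth
      falls by at most one per step and ends at \<open>h f\<close>, which is at most
      \<open>h e\<close>. So the path reaches depth \<open>h e\<close> before getting nearer to the
      root, that is, within \<open>D\<close>.\<close>
    then have "w \<in> verts (t f) \<Longrightarrow> h e \<le> ?d w \<Longrightarrow> \<exists>x\<in>verts (t f). ?d x = h e \<and> (w, x) \<in> D\<^sup>*"
    proof (induction rule: converse_rtrancl_induct)
      case base
      then show ?case
        using m'(2) h_max[OF f(1)] by (intro bexI[of _ m']) auto
    next
      case (step y z)
      show ?case
      proof (cases "?d y = h e")
        case True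
        then show ?thesis
          using step.prems(1) by blast
      next
        case False
        have z: "z \<in> verts (t f)" "(y, z) \<in> ?R"
          using step.hyps(1) by auto
        then have "?d y \<le> Suc (?d z)"
          using reach[OF z(1) f(1)] sym_arcs[of T] by (intro depth_step_le) (auto dest: symD)
        then have "h e \<le> ?d z"
          using False step.prems(2) by simp
        moreover from this have "(y, z) \<in> D"
          using z(2) step.prems(2) by (simp add: D_def)
        ultimately show ?thesis
          using step.IH z(1) by (meson converse_rtrancl_into_rtrancl)
      qed
    qed
    then obtain x where x: "x \<in> verts (t f)" "?d x = h e" "(w, x) \<in> D\<^sup>*"
      using w h_le by blast
    \<comment> \<open>Both lie at depth \<open>h e\<close> in the same component of the part at
      depth at least \<open>h e\<close>.\<close>
    have "m = x"
    proof (rule unique_top[OF sym_arcs tree_edge_is_bridge[OF assms(1)]])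
      show "(m, x) \<in> (Restr ?R {x. h e \<le> ?d x})\<^sup>*"
        using mw x(3) unfolding D_def by (rule rtrancl_trans)
    qed (use m x reach e f in auto)
    then show ?thesis
      using x(1) by simp
  qed
  then show ?thesis
    using e(1) by blast
qed

section \<open>Point-tree hypergraphs\<close>

lemma width_le: "C \<subseteq> F \<Longrightarrow> finite C \<Longrightarrow> H_covering H C \<Longrightarrow> width H F \<le> card C"
  unfolding width_def by (rule Least_le) blast

lemma card_matching_le:
  assumes "finite H" "matching H M"
  shows "card M \<le> matching_number H"
proof -
  have "{card M |M. matching H M} \<subseteq> card ` Pow H"
    by (auto simp: matching_def)
  then have "finite {card M |M. matching H M}"
    using assms(1) by (meson finite_Pow_iff finite_imageI finite_subset)
  then show ?thesis
    unfolding matching_number_def using assms(2) by (intro Max_ge) auto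
qed

theorem theorem2p1:
  fixes X :: "'a set" and T :: "'a ugraph" and H :: "'a set set"
  assumes "point_tree_hypergraph X T H"
    and "finite H"
  shows "sigma X T H \<le> matching_number H"
proof (rule ccontr)
  assume "\<not> sigma X T H \<le> matching_number H"
  have tree: "tree T" and disj: "X \<inter> verts T = {}"
    using assms(1) by (auto simp: point_tree_hypergraph_def)
  have "\<forall>e\<in>H. \<exists>x t. x \<in> X \<and> subtree t T \<and> e = {x} \<union> verts t"
    using assms(1) unfolding point_tree_hypergraph_def by blast
  then obtain x t where xt: "\<And>e. e \<in> H \<Longrightarrow> x e \<in> X \<and> subtree (t e) T \<and> e = {x e} \<union> verts (t e)"
    by metis
  have x_in: "x e \<in> e" and t_in: "verts (t e) \<subseteq> e" if "e \<in> H" for e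
    using xt[OF that] by auto
  have parts: "{x e} \<in> point_tree_parts X T H" "verts (t e) \<in> point_tree_parts X T H" if "e \<in> H" for e
  proof -
    have "x e \<in> X \<and> subtree (t e) T \<and> {x e} \<union> verts (t e) \<in> H"
      using xt[OF that] that by simp
    then show "{x e} \<in> point_tree_parts X T H" "verts (t e) \<in> point_tree_parts X T H"
      unfolding point_tree_parts_def by blast+
  qed
  define n where "n = matching_number H"
  have cover_large: "n < card C"
    if "C \<subseteq> point_tree_parts X T H" "finite C" "H_covering H C" for C
    using width_le[OF that] \<open>\<not> sigma X T H \<le> matching_number H\<close> by (simp add: sigma_def n_def)
  define Y where "Y = x ` H"
  have finY: "finite Y"
    using assms(2) by (simp add: Y_def)
  \<comment> \<open>The covering consists of the points outside \<open>S\<close> and the subtrees of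
    \<open>D\<close>; the bound is arranged to avoid subtraction.\<close>
  have point_cover: "n + card S < card Y + card D"
    if S: "S \<subseteq> Y" and D: "D \<subseteq> H"
      and dom: "\<And>e. e \<in> H \<Longrightarrow> x e \<in> S \<Longrightarrow> \<exists>d\<in>D. verts (t d) \<inter> verts (t e) \<noteq> {}" for S D
  proof -
    let ?C = "(\<lambda>y. {y}) ` (Y - S) \<union> (\<lambda>e. verts (t e)) ` D"
    have finD: "finite D"
      using D assms(2) by (rule finite_subset)
    have "H_covering H ?C"
      unfolding H_covering_def
    proof
      fix e assume e: "e \<in> H"
      show "\<exists>c\<in>?C. e \<inter> c \<noteq> {}"
      proof (cases "x e \<in> S")
        case True
        then obtain d where "d \<in> D" "verts (t d) \<inter> verts (t e) \<noteq> {}"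
          using dom[OF e] by blast
        then show ?thesis
          using t_in[OF e] by (intro bexI[of _ "verts (t d)"]) auto
      next
        case False
        then show ?thesis
          using x_in[OF e] e by (intro bexI[of _ "{x e}"]) (auto simp: Y_def)
      qed
    qed
    moreover have "?C \<subseteq> point_tree_parts X T H"
      using parts D by (auto simp: Y_def)
    ultimately have "n < card ?C"
      using finY finD by (intro cover_large) auto
    also have "\<dots> \<le> card (Y - S) + card D"
      using card_Un_le card_image_le[of "Y - S" "\<lambda>y. {y}"] card_image_le[OF finD, of "\<lambda>e. verts (t e)"] finY
      by (meson add_mono finite_Diff le_trans)
    also have "card (Y - S) = card Y - card S"
      using S finY by (intro card_Diff_subset) (auto intro: finite_subset)
    finally show ?thesis
      using card_mono[OF finY S] by linarith
  qed
  \<comment> \<open>The number of colours beyond the \<open>n + 1\<close> wanted. Empty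
    \<open>S\<close> and \<open>D\<close> in \<open>point_cover\<close> give
    \<open>n < card Y\<close>, so the subtraction does not truncate.\<close>
  define d where "d = card Y - Suc n"
  have card_Y: "card Y = Suc n + d"
    using point_cover[of "{}" "{}"] by (simp add: d_def)
  \<comment> \<open>The \<open>d\<close> cliques \<open>{Inr (y, j) | y. y \<in> Y}\<close> of dummy vertices absorb the deficiency, so that
    Hall's condition holds exactly: each costs one vertex to dominate and can serve one colour.\<close>
  define V where "V = Inl ` H \<union> Inr ` (Y \<times> {..<d})"
  define col where "col = case_sum x (fst :: 'a \<times> nat \<Rightarrow> 'a)"
  \<comment> \<open>The disjunct \<open>u = v\<close> secures reflexivity everywhere, since
    \<open>t e\<close> is arbitrary for \<open>e\<close> outside \<open>H\<close>.\<close>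
  define adj where "adj u v = (u = v \<or> (case (u, v) of
      (Inl e, Inl f) \<Rightarrow> verts (t e) \<inter> verts (t f) \<noteq> {}
    | (Inr p, Inr q) \<Rightarrow> snd p = snd q
    | _ \<Rightarrow> False))" for u v :: "'a set + 'a \<times> nat"
  have adj_simps [simp]:
    "adj (Inl e) (Inl f) \<longleftrightarrow> e = f \<or> verts (t e) \<inter> verts (t f) \<noteq> {}"
    "adj (Inr p) (Inr q) \<longleftrightarrow> snd p = snd q"
    "\<not> adj (Inl e) (Inr q)" "\<not> adj (Inr p) (Inl f)" for e f p q
    by (auto simp: adj_def)
  have col_simps [simp]: "col (Inl e) = x e" "col (Inr p) = fst p" for e p
    by (simp_all add: col_def)
  have finV: "finite V"
    using assms(2) finY by (simp add: V_def)
  obtain \<sigma> where \<sigma>: "\<sigma> \<subseteq> V" "independent adj \<sigma>" "bij_betw col \<sigma> Y"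
  proof (rule chordal_rainbow_independent[OF finV _ _ finY, of adj col])
    show "reflp adj" "symp adj"
      by (auto simp: reflp_def symp_def adj_def split: sum.splits)
    show "\<exists>v. simplicial adj U v" if U: "U \<subseteq> V" "U \<noteq> {}" for U
    proof (cases "\<exists>p. Inr p \<in> U")
      case True
      then obtain p where p: "Inr p \<in> U"
        by blast
      \<comment> \<open>The neighbours of a dummy vertex are exactly the dummies with the same index
        \<open>j\<close>.\<close>
      have "adj a b" if "adj (Inr p) a" "adj (Inr p) b" for a b
        using that by (cases a; cases b) auto
      then show ?thesis
        using p unfolding simplicial_def by blast
    next
      case False
      define U' where "U' = {e. Inl e \<in> U}"
      have U_eq: "U = Inl ` U'"
      proof (rule set_eqI)
        show "v \<in> U \<longleftrightarrow> v \<in> Inl ` U'" for v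
          using False by (cases v) (auto simp: U'_def)
      qed
      have U': "U' \<subseteq> H"
        using U(1) by (auto simp: U'_def V_def)
      obtain e m where e: "e \<in> U'" "\<And>f. f \<in> U' \<Longrightarrow> verts (t e) \<inter> verts (t f) \<noteq> {} \<Longrightarrow> m \<in> verts (t f)"
        using subtrees_common_vertex[OF tree, of U' t] xt U' U(2) assms(2) finite_subset U_eq
        by (metis image_empty subsetD)
      \<comment> \<open>The subtrees of all neighbours of \<open>e\<close> share \<open>m\<close>,
        so they meet pairwise.\<close>
      have "m \<in> verts (t f)" if "f \<in> U'" "adj (Inl e) (Inl f)" for f
      proof -
        have "verts (t f) \<noteq> {}"
          using subtree_nonempty xt U' that(1) by blast
        then show ?thesis
          using that e(2) by auto
      qed
      then have "simplicial adj U (Inl e)"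
        unfolding simplicial_def U_eq using e(1) by auto
      then show ?thesis
        by blast
    qed
    \<comment> \<open>\<open>D\<close> splits into \<open>D1\<close>, to which
      \<open>point_cover\<close> applies, and \<open>D2\<close>, which must meet each of the
      \<open>d\<close> cliques once \<open>S\<close> contains some colour \<open>s\<close>.\<close>
    show "card S \<le> card D" if S: "S \<subseteq> Y" and D: "dominating adj {v \<in> V. col v \<in> S} D" for S D
    proof (cases "S = {}")
      case False
      then obtain s where s: "s \<in> S"
        by blast
      define D1 where "D1 = {e. Inl e \<in> D}"
      define D2 where "D2 = {p. Inr p \<in> D}"
      have D_eq: "D = Inl ` D1 \<union> Inr ` D2"
      proof (rule set_eqI)
        show "v \<in> D \<longleftrightarrow> v \<in> Inl ` D1 \<union> Inr ` D2" for v
          by (cases v) (auto simp: D1_def D2_def)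
      qed
      have DV: "D \<subseteq> V"
        using D by (auto simp: dominating_def)
      then have finD: "finite D"
        using finV by (rule finite_subset)
      then have fin12: "finite D1" "finite D2"
        unfolding D_eq by (simp_all add: finite_image_iff)
      have "card D = card D1 + card D2"
        unfolding D_eq using fin12 by (subst card_Un_disjoint) (auto simp: card_image)
      moreover have "n + card S < card Y + card D1"
      proof (rule point_cover[OF S])
        show "D1 \<subseteq> H"
          using DV by (auto simp: D1_def V_def)
        fix e assume e: "e \<in> H" "x e \<in> S"
        then have "Inl e \<in> {v \<in> V. col v \<in> S}"
          by (simp add: V_def)
        then obtain v where v: "v \<in> D" "adj v (Inl e)"
          using D unfolding dominating_def by blast
        then obtain f where "f \<in> D1" "adj (Inl f) (Inl e)"
          by (cases v) (auto simp: D1_def)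
        moreover have "verts (t e) \<noteq> {}"
          using subtree_nonempty xt e(1) by blast
        ultimately show "\<exists>d\<in>D1. verts (t d) \<inter> verts (t e) \<noteq> {}"
          by (intro bexI[of _ f]) auto
      qed
      moreover have "{..<d} \<subseteq> snd ` D2"
      proof
        fix j assume "j \<in> {..<d}"
        then have "Inr (s, j) \<in> {v \<in> V. col v \<in> S}"
          using s S by (auto simp: V_def)
        then obtain v where "v \<in> D" "adj v (Inr (s, j))"
          using D unfolding dominating_def by blast
        then show "j \<in> snd ` D2"
          by (cases v) (auto simp: D2_def image_iff)
      qed
      then have "d \<le> card D2"
        using fin12(2) surj_card_le[of D2 "{..<d}" snd] by simp
      ultimately show ?thesis
        using card_Y by linarith
    qed simp
  qed
  define M where "M = {e. Inl e \<in> \<sigma>}"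
  define P where "P = {p. Inr p \<in> \<sigma>}"
  have \<sigma>_eq: "\<sigma> = Inl ` M \<union> Inr ` P"
  proof (rule set_eqI)
    show "v \<in> \<sigma> \<longleftrightarrow> v \<in> Inl ` M \<union> Inr ` P" for v
      by (cases v) (auto simp: M_def P_def)
  qed
  have "finite \<sigma>"
    using \<sigma>(1) finV by (rule finite_subset)
  then have fin: "finite M" "finite P"
    unfolding \<sigma>_eq by (simp_all add: finite_image_iff)
  have "card \<sigma> = card M + card P"
    unfolding \<sigma>_eq using fin by (subst card_Un_disjoint) (auto simp: card_image)
  moreover have "card \<sigma> = card Y"
    using \<sigma>(3) by (rule bij_betw_same_card)
  \<comment> \<open>\<open>\<sigma>\<close> takes at most one dummy from each clique, so at least
    \<open>n + 1\<close> of its vertices are edges of \<open>H\<close>.\<close>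
  moreover have "card P \<le> card {..<d}"
  proof (rule card_inj_on_le[of snd])
    have "\<not> adj (Inr p) (Inr q)" if "p \<in> P" "q \<in> P" "p \<noteq> q" for p q
      using that \<sigma>(2) unfolding independent_def P_def by blast
    then show "inj_on snd P"
      unfolding inj_on_def by auto
    show "snd ` P \<subseteq> {..<d}"
      using \<sigma>(1) by (auto simp: P_def V_def)
  qed simp
  ultimately have "n < card M"
    using card_Y by simp
  moreover have "matching H M"
    unfolding matching_def
  proof
    show MH: "M \<subseteq> H"
      using \<sigma>(1) by (auto simp: M_def V_def)
    show "disjoint M"
    proof (rule disjointI)
      \<comment> \<open>Independence separates the subtrees, distinct colours separate the points,
        and \<open>X\<close> is disjoint from the tree.\<close>
      fix e f assume ef: "e \<in> M" "f \<in> M" "e \<noteq> f"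
      then have "\<not> adj (Inl e) (Inl f)"
        using \<sigma>(2) unfolding independent_def M_def by blast
      then have "verts (t e) \<inter> verts (t f) = {}"
        by simp
      moreover have "x e \<noteq> x f"
        using \<sigma>(3) ef unfolding bij_betw_def inj_on_def M_def by force
      moreover have "x e \<notin> verts (t f)" "x f \<notin> verts (t e)"
        using xt ef MH disj unfolding subtree_def by blast+
      ultimately have "({x e} \<union> verts (t e)) \<inter> ({x f} \<union> verts (t f)) = {}"
        by blast
      moreover have "e = {x e} \<union> verts (t e)" "f = {x f} \<union> verts (t f)"
        using xt ef MH by blast+
      ultimately show "e \<inter> f = {}"
        by metis
    qed
  qed
  ultimately show False
    using card_matching_le[OF assms(2), of M] by (simp add: n_def)
qed

end
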